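(* Let $\mathcal{O}$ be a set of admissible shapes and, for $\Omega\in\mathcal{O}$, let $\gamma=\gamma(\Omega)$ be the crack initiation process associated with a local Weibull model with shape parameter $m\ge1$. Let $t>0$ be a given time. Then: (i) $\Omega^*\in\mathcal{O}$ is a solution to the optimal reliability problem in the sense of instantaneous hazard if and only if it solves the optimal reliability problem at the fixed time $t$. (ii) $\Omega^*\in\mathcal{O}$ is a solution to the optimal reliability problem at the fixed time $t$ if and only if $$\mathcal{J}(\Omega^*,u,T)\le\mathcal{J}(\Omega,u,T)\quad\forall\,\Omega\in\mathcal{O},$$ where $$\mathcal{J}(\Omega,u,T)=\int_\Omega\left(\frac{1}{N_{vol}(x,T,\nabla T,u,\nabla u,\nabla^2u,\nabla^3u)}\right)^m dx+\int_{\partial\Omega}\left(\frac{1}{N_{sur}(x,T,\nabla T,u,\nabla u,\nabla^2u,\nabla^3u)}\right)^m dA .$$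
   Context: Each $\Omega\in\mathcal{O}$ is a bounded domain in $\mathbb{R}^3$ with associated temperature field $T=T(\Omega):\bar\Omega\to\mathbb{R}$ and displacement field $u=u(\Omega):\bar\Omega\to\mathbb{R}^3$; in $\mathcal{J}(\Omega,u,T)$ one takes $u=u(\Omega)$, $T=T(\Omega)$. $dA$ is surface measure. Local Weibull model: $\gamma(\Omega)$ is a Poisson point process on $[0,\infty)\times\bar\Omega$ with Radon intensity measure $$\rho(\Omega,C)=\int_{C\cap(\mathbb{R}\times\Omega)}\varrho_{vol}\,dt\,dx+\int_{C\cap(\mathbb{R}\times\partial\Omega)}\varrho_{sur}\,dt\,dA,\qquad \varrho_{vol/sur}(t,\cdot)=\frac{m}{N_{vol/sur}(\cdot)}\left(\frac{t}{N_{vol/sur}(\cdot)}\right)^{m-1},$$ where $N_{vol/sur}(\cdot)=N_{vol/sur}(x,T,\nabla T,u,\nabla u,\nabla^2u,\nabla^3u)$ take values in $[0,\infty]$, with $\frac1\infty=0$ (one of them may be identically infinite). The first failure time is $\tau=\tau(\Omega)=\inf\{t\ge0:\gamma([0,t]\times\bar\Omega)>0\}$, with distribution function $F_\tau$, density $f_\tau$ and hazard rate $h_\tau(t)=f_\tau(t)/(1-F_\tau(t))$. $\Omega^*\in\mathcal{O}$ solves the optimal reliability problem at fixed time $t$ if $F_{\tau(\Omega^* )}(t)\le F_{\tau(\Omega)}(t)$ for all $\Omega\in\mathcal{O}$; it solves the optimal reliability problem in the sense of instantaneous hazard if $h_{\tau(\Omega^* )}(s)\le h_{\tau(\Omega)}(s)$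 for all $s\ge0$ and all $\Omega\in\mathcal{O}$. *)

theory Defs
  imports "HOL-Probability.Probability"
begin

section \<open>Surface measure\<close>

text \<open>
  The surface measure is the two-dimensional Hausdorff measure on the Borel sets. The factor
  \<open>pi / 4\<close> is the area of a disc of diameter 1; with it the Hausdorff measure agrees with
  the classical area of (piecewise) smooth surfaces. Boundedness of the covering sets is
  required because \<^const>\<open>diameter\<close> is a junk value on unbounded sets.
\<close>

definition area_premeasure :: "real \<Rightarrow> 'a::metric_space set \<Rightarrow> ennreal" where
  "area_premeasure \<delta> A =
     (INF U\<in>{U :: nat \<Rightarrow> 'a set. A \<subseteq> (\<Union>i. U i) \<and> (\<forall>i. bounded (U i) \<and> diameter (U i) \<le> \<delta>)}.
        \<Sum>i. ennreal (pi / 4 * (diameter (U i))\<^sup>2))"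

definition hausdorff_area :: "'a::metric_space set \<Rightarrow> ennreal" where
  "hausdorff_area A = (SUP \<delta>\<in>{0<..}. area_premeasure \<delta> A)"

definition surface_measure :: "'a::metric_space measure" where
  "surface_measure = measure_of UNIV (sets borel) hausdorff_area"

text \<open>
  Metric outer measure property and Caratheodory's criterion: the Hausdorff measure is
  countably additive on the Borel sets, so \<^const>\<open>measure_of\<close> above is not degenerate.
\<close>

lemma sets_surface_measure [measurable_cong]: "sets surface_measure = sets borel"
  unfolding surface_measure_def using sets.sigma_sets_eq[of borel] by simp

lemma area_premeasure_mono: "A \<subseteq> B \<Longrightarrow> area_premeasure \<delta> A \<le> area_premeasure \<delta> B"
  unfolding area_premeasure_def by (rule INF_superset_mono) auto

lemma area_premeasure_antimono: "\<delta> \<le> \<delta>' \<Longrightarrow> area_premeasure \<delta>' A \<le> area_premeasure \<delta> A"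
  unfolding area_premeasure_def
  by (rule INF_superset_mono) (use order_trans[of _ \<delta> \<delta>'] in blast, simp)

lemma area_premeasure_le:
  "A \<subseteq> (\<Union>i. U i) \<Longrightarrow> (\<And>i. bounded (U i) \<and> diameter (U i) \<le> \<delta>) \<Longrightarrow>
   area_premeasure \<delta> A \<le> (\<Sum>i. ennreal (pi / 4 * (diameter (U i))\<^sup>2))"
  unfolding area_premeasure_def by (rule INF_lower) auto

lemma area_premeasure_empty: "0 < \<delta> \<Longrightarrow> area_premeasure \<delta> {} = 0"
  using area_premeasure_le[of "{}" "\<lambda>_. {}" \<delta>] by auto

lemma area_premeasure_UN:
  fixes A :: "nat \<Rightarrow> 'a::metric_space set"
  shows "area_premeasure \<delta> (\<Union>n. A n) \<le> (\<Sum>n. area_premeasure \<delta> (A n))"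
proof (rule ennreal_le_epsilon)
  fix e :: real assume e: "0 < e" "(\<Sum>n. area_premeasure \<delta> (A n)) < top"
  let ?f = "\<lambda>V :: 'a set. ennreal (pi / 4 * (diameter V)\<^sup>2)"
  have *: "area_premeasure \<delta> (A n) < area_premeasure \<delta> (A n) + e * (1/2)^Suc n" for n
    using e by (auto simp add: less_top dest!: ennreal_suminf_lessD)
  have "\<exists>U. A n \<subseteq> (\<Union>i. U i) \<and> (\<forall>i. bounded (U i) \<and> diameter (U i) \<le> \<delta>) \<and>
          (\<Sum>i. ?f (U i)) < area_premeasure \<delta> (A n) + e * (1/2)^Suc n" for n
    using *[of n] unfolding area_premeasure_def[of \<delta> "A n"] INF_less_iff by auto
  then have "\<exists>U. \<forall>n. A n \<subseteq> (\<Union>i. U n i) \<and> (\<forall>i. bounded (U n i) \<and> diameter (U n i) \<le> \<delta>) \<and>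
          (\<Sum>i. ?f (U n i)) < area_premeasure \<delta> (A n) + e * (1/2)^Suc n"
    by (intro choice allI)
  then obtain U where U: "\<And>n. A n \<subseteq> (\<Union>i. U n i)"
      "\<And>n i. bounded (U n i) \<and> diameter (U n i) \<le> \<delta>"
      "\<And>n. (\<Sum>i. ?f (U n i)) < area_premeasure \<delta> (A n) + e * (1/2)^Suc n"
    by blast
  define C where "C = case_prod U o prod_decode"
  have "(\<Union>n. A n) \<subseteq> (\<Union>i. C i)"
  proof safe
    fix x n assume "x \<in> A n"
    then obtain i where "x \<in> U n i" using U(1) by blast
    then have "x \<in> C (prod_encode (n, i))" by (simp add: C_def)
    then show "x \<in> (\<Union>i. C i)" by blast
  qed
  then have "area_premeasure \<delta> (\<Union>n. A n) \<le> (\<Sum>i. ?f (C i))"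
    using U(2) by (intro area_premeasure_le) (auto simp: C_def split_def)
  also have "\<dots> = (\<Sum>n. \<Sum>i. ?f (U n i))"
    unfolding C_def comp_def
    by (intro suminf_ennreal_2dimen) auto
  also have "\<dots> \<le> (\<Sum>n. area_premeasure \<delta> (A n) + e * (1/2) ^ Suc n)"
    by (intro suminf_le less_imp_le[OF U(3)]) auto
  also have "\<dots> = (\<Sum>n. area_premeasure \<delta> (A n)) + (\<Sum>n. ennreal e * ennreal ((1/2) ^ Suc n))"
    using e by (subst suminf_add[symmetric])
      (auto simp del: ennreal_suminf_cmult simp add: ennreal_mult[symmetric])
  also have "\<dots> = (\<Sum>n. area_premeasure \<delta> (A n)) + e"
    unfolding ennreal_suminf_cmult
    by (subst suminf_ennreal_eq[OF zero_le_power power_half_series]) auto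
  finally show "area_premeasure \<delta> (\<Union>n. A n) \<le> (\<Sum>n. area_premeasure \<delta> (A n)) + e" .
qed

lemma outer_measure_space_hausdorff_area: "outer_measure_space (Pow UNIV) hausdorff_area"
  unfolding outer_measure_space_def
proof (intro conjI)
  show "positive (Pow UNIV) hausdorff_area"
    by (simp add: positive_def hausdorff_area_def area_premeasure_empty)
  show "increasing (Pow UNIV) hausdorff_area"
    unfolding increasing_def hausdorff_area_def
    by (intro ballI impI SUP_mono' area_premeasure_mono)
  show "countably_subadditive (Pow UNIV) (hausdorff_area :: 'a set \<Rightarrow> _)"
    unfolding countably_subadditive_def
  proof (intro allI impI)
    fix A :: "nat \<Rightarrow> 'a set"
    show "hausdorff_area (\<Union>i. A i) \<le> (\<Sum>i. hausdorff_area (A i))"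
      unfolding hausdorff_area_def[of "\<Union>i. A i"]
    proof (rule SUP_least)
      fix \<delta> :: real assume "\<delta> \<in> {0<..}"
      then have "(\<Sum>i. area_premeasure \<delta> (A i)) \<le> (\<Sum>i. hausdorff_area (A i))"
        by (intro suminf_le) (auto simp: hausdorff_area_def intro: SUP_upper)
      with area_premeasure_UN[of \<delta> A]
      show "area_premeasure \<delta> (\<Union>i. A i) \<le> (\<Sum>i. hausdorff_area (A i))"
        by (rule order_trans)
    qed
  qed
qed

lemma area_premeasure_separated:
  assumes sep: "\<And>x y. x \<in> A \<Longrightarrow> y \<in> B \<Longrightarrow> r \<le> dist x y" and "0 < \<delta>" "\<delta> < r"
  shows "area_premeasure \<delta> A + area_premeasure \<delta> B \<le> area_premeasure \<delta> (A \<union> B)"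
  unfolding area_premeasure_def[of \<delta> "A \<union> B"]
proof (rule INF_greatest)
  fix U :: "nat \<Rightarrow> 'a set"
  assume "U \<in> {U. A \<union> B \<subseteq> (\<Union>i. U i) \<and> (\<forall>i. bounded (U i) \<and> diameter (U i) \<le> \<delta>)}"
  then have U: "A \<subseteq> (\<Union>i. U i)" "B \<subseteq> (\<Union>i. U i)"
    "\<forall>i. bounded (U i) \<and> diameter (U i) \<le> \<delta>" by auto
  let ?f = "\<lambda>V :: 'a set. ennreal (pi / 4 * (diameter V)\<^sup>2)"
  have sub: "bounded V \<and> diameter V \<le> diameter (U i)" if "V \<subseteq> U i" for V i
    using U(3) that by (meson bounded_subset diameter_subset)
  have pre: "area_premeasure \<delta> X \<le> (\<Sum>i. ?f (U i \<inter> X))" if "X \<subseteq> (\<Union>i. U i)" for X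
  proof (rule area_premeasure_le)
    show "X \<subseteq> (\<Union>i. U i \<inter> X)" using that by auto
    show "bounded (U i \<inter> X) \<and> diameter (U i \<inter> X) \<le> \<delta>" for i
      using sub[of "U i \<inter> X" i] U(3) order_trans[of "diameter (U i \<inter> X)" "diameter (U i)" \<delta>] by simp
  qed
  have le: "?f (U i \<inter> A) + ?f (U i \<inter> B) \<le> ?f (U i)" for i
  proof -
    have "U i \<inter> A = {} \<or> U i \<inter> B = {}"
    proof (rule ccontr)
      assume "\<not> ?thesis"
      then obtain x y where "x \<in> U i" "x \<in> A" "y \<in> U i" "y \<in> B" by auto
      then show False
        using diameter_bounded_bound[of "U i" x y] U(3) sep[of x y] \<open>\<delta> < r\<close>
        by (smt (verit))
    qed
    moreover have "?f V \<le> ?f (U i)" if "V \<subseteq> U i" for V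
      using sub[OF that] that U(3)
      by (intro ennreal_leI mult_left_mono power_mono diameter_ge_0) auto
    ultimately show ?thesis by auto
  qed
  have "area_premeasure \<delta> A + area_premeasure \<delta> B \<le> (\<Sum>i. ?f (U i \<inter> A)) + (\<Sum>i. ?f (U i \<inter> B))"
    using U by (intro add_mono pre)
  also have "\<dots> = (\<Sum>i. ?f (U i \<inter> A) + ?f (U i \<inter> B))"
    by (rule suminf_add) auto
  also have "\<dots> \<le> (\<Sum>i. ?f (U i))"
    by (intro suminf_le le) auto
  finally show "area_premeasure \<delta> A + area_premeasure \<delta> B \<le> (\<Sum>i. ?f (U i))" .
qed

lemma hausdorff_area_separated:
  assumes sep: "\<And>x y. x \<in> A \<Longrightarrow> y \<in> B \<Longrightarrow> r \<le> dist x y" and "0 < r"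
  shows "hausdorff_area A + hausdorff_area B \<le> hausdorff_area (A \<union> B)"
proof -
  have le: "area_premeasure \<delta> A + area_premeasure \<delta>' B \<le> hausdorff_area (A \<union> B)"
    if "0 < \<delta>" "0 < \<delta>'" for \<delta> \<delta>'
  proof -
    let ?d = "min (min \<delta> \<delta>') (r / 2)"
    have "area_premeasure \<delta> A + area_premeasure \<delta>' B \<le> area_premeasure ?d A + area_premeasure ?d B"
      by (intro add_mono area_premeasure_antimono) auto
    also have "\<dots> \<le> area_premeasure ?d (A \<union> B)"
      using that \<open>0 < r\<close> by (intro area_premeasure_separated[of A B r] sep) auto
    also have "\<dots> \<le> hausdorff_area (A \<union> B)"
      unfolding hausdorff_area_def using that \<open>0 < r\<close> by (intro SUP_upper) auto
    finally show ?thesis .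
  qed
  have ne: "{0<..} \<noteq> ({} :: real set)"
    using greaterThan_non_empty by blast
  have 1: "hausdorff_area A + area_premeasure \<delta>' B \<le> hausdorff_area (A \<union> B)" if "0 < \<delta>'" for \<delta>'
    unfolding hausdorff_area_def[of A]
    using le[OF _ that] by (subst ennreal_SUP_add_left[symmetric]) (auto simp: ne intro!: SUP_least)
  show ?thesis
    unfolding hausdorff_area_def[of B]
    using 1 by (subst ennreal_SUP_add_right[OF ne]) (auto intro!: SUP_least)
qed

lemma closed_in_lambda_system_hausdorff_area:
  fixes F :: "'a::metric_space set"
  assumes "closed F"
  shows "F \<in> lambda_system UNIV (Pow UNIV) hausdorff_area"
proof (cases "F = {}")
  case True
  then show ?thesis
    using outer_measure_space_hausdorff_area
    by (auto simp: lambda_system_def outer_measure_space_def positive_def)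
next
  case False
  let ?h = "hausdorff_area :: 'a set \<Rightarrow> ennreal"
  interpret P: sigma_algebra UNIV "Pow UNIV :: 'a set set" by (rule sigma_algebra_Pow)
  have oms: "positive (Pow UNIV) ?h" "increasing (Pow UNIV) ?h" "countably_subadditive (Pow UNIV) ?h"
    using outer_measure_space_hausdorff_area by (auto simp: outer_measure_space_def)
  have mono: "?h X \<le> ?h Y" if "X \<subseteq> Y" for X Y
    using oms(2) that by (auto simp: increasing_def)
  have "subadditive (Pow UNIV) ?h"
    using oms by (intro P.countably_subadditive_subadditive)
  have sub: "?h (X \<union> Y) \<le> ?h X + ?h Y" for X Y
  proof -
    have "?h (X \<union> (Y - X)) \<le> ?h X + ?h (Y - X)"
      using \<open>subadditive (Pow UNIV) ?h\<close> by (intro subadditiveD) auto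
    also have "\<dots> \<le> ?h X + ?h Y" by (intro add_mono mono) auto
    finally show ?thesis by simp
  qed
  have csub: "?h (\<Union>i. X i) \<le> (\<Sum>i. ?h (X i))" for X :: "nat \<Rightarrow> 'a set"
  proof -
    have "?h (\<Union>i. disjointed X i) \<le> (\<Sum>i. ?h (disjointed X i))"
      using oms(3) disjoint_family_disjointed[of X] by (auto simp: countably_subadditive_def)
    also have "\<dots> \<le> (\<Sum>i. ?h (X i))"
      by (intro suminf_le mono disjointed_subset) auto
    finally show ?thesis by (simp add: UN_disjointed_eq)
  qed
  have main: "?h (A \<inter> F) + ?h (A - F) \<le> ?h A" for A
  proof (cases "?h A = \<infinity>")
    case True then show ?thesis by simp
  next
    case fin: False
    define S where "S n = {x \<in> A. 1 / real (Suc n) \<le> infdist x F}" for n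
    define D where "D n = {x \<in> A. 1 / real (n + 2) \<le> infdist x F \<and> infdist x F < 1 / real (n + 1)}" for n
    have SA: "S n \<subseteq> A - F" for n
      by (auto simp: S_def)
    have cover: "A - F \<subseteq> S n \<union> (\<Union>k. D (k + n))" for n
    proof
      fix x assume x: "x \<in> A - F"
      then have pos: "0 < infdist x F"
        using in_closed_iff_infdist_zero[OF \<open>closed F\<close> False] infdist_nonneg[of x F]
        by (metis DiffD2 less_eq_real_def)
      then obtain j where j: "1 / real (Suc j) \<le> infdist x F"
        by (metis inverse_eq_divide less_imp_le reals_Archimedean)
      define j0 where "j0 = (LEAST j. 1 / real (Suc j) \<le> infdist x F)"
      have j0: "1 / real (Suc j0) \<le> infdist x F"
        unfolding j0_def using j by (rule LeastI)
      show "x \<in> S n \<union> (\<Union>k. D (k + n))"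
      proof (cases "j0 \<le> n")
        case True
        then have "1 / real (Suc n) \<le> 1 / real (Suc j0)" by (auto simp: field_simps)
        with j0 x show ?thesis by (auto simp: S_def)
      next
        case F: False
        then obtain k where k: "j0 = Suc (k + n)"
          by (metis add.commute less_imp_Suc_add not_le)
        have "\<not> 1 / real (Suc (k + n)) \<le> infdist x F"
          using not_less_Least[of "k + n" "\<lambda>j. 1 / real (Suc j) \<le> infdist x F"] k
          unfolding j0_def[symmetric] by simp
        with j0 k x have "x \<in> D (k + n)" by (auto simp: D_def)
        then show ?thesis by auto
      qed
    qed
    have sepd: "?h X + ?h Y \<le> ?h (X \<union> Y)"
      if "\<And>x. x \<in> X \<Longrightarrow> a \<le> infdist x F" "\<And>y. y \<in> Y \<Longrightarrow> infdist y F \<le> b" "b < a" for X Y a b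
    proof (rule hausdorff_area_separated[of _ _ "a - b"])
      fix x y assume "x \<in> X" "y \<in> Y"
      then show "a - b \<le> dist x y"
        using infdist_triangle[of x F y] that(1)[of x] that(2)[of y] by auto
    qed (use that in auto)
    have part: "(\<Sum>k<n. ?h (D (2 * k + p))) \<le> ?h A" for n p
    proof -
      have "(\<Sum>k<n. ?h (D (2 * k + p))) \<le> ?h (\<Union>k<n. D (2 * k + p))"
      proof (induction n)
        case (Suc n)
        have "?h (\<Union>k<n. D (2 * k + p)) + ?h (D (2 * n + p))
              \<le> ?h ((\<Union>k<n. D (2 * k + p)) \<union> D (2 * n + p))"
        proof (cases "n = 0")
          case True
          then show ?thesis using oms(1) by (simp add: positive_def)
        next
          case False
          show ?thesis
          proof (rule sepd[of _ "1 / real (2 * n + p)" _ "1 / real (2 * n + p + 1)"])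
            fix x assume "x \<in> (\<Union>k<n. D (2 * k + p))"
            then obtain k where k: "k < n" "1 / real (2 * k + p + 2) \<le> infdist x F"
              by (auto simp: D_def)
            have "1 / real (2 * n + p) \<le> 1 / real (2 * k + p + 2)"
              using k by (intro divide_left_mono) (auto intro!: mult_pos_pos)
            with k show "1 / real (2 * n + p) \<le> infdist x F" by linarith
          next
            show "1 / real (2 * n + p + 1) < 1 / real (2 * n + p)"
              using False by (intro divide_strict_left_mono) auto
          qed (auto simp: D_def)
        qed
        then have "(\<Sum>k<n. ?h (D (2 * k + p))) + ?h (D (2 * n + p))
            \<le> ?h ((\<Union>k<n. D (2 * k + p)) \<union> D (2 * n + p))"
          using add_right_mono[OF Suc.IH] order_trans by blast
        then show ?case by (simp add: lessThan_Suc Un_commute add.commute)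
      qed (use oms(1) in \<open>simp add: positive_def\<close>)
      also have "\<dots> \<le> ?h A" by (rule mono) (auto simp: D_def)
      finally show ?thesis .
    qed
    have "(\<Sum>k<n. ?h (D k)) \<le> 2 * ?h A" for n
    proof -
      have split: "(\<Sum>k<2*n. g k) = (\<Sum>k<n. g (2 * k)) + (\<Sum>k<n. g (2 * k + 1))" for g :: "nat \<Rightarrow> ennreal"
        by (induction n) (auto simp: algebra_simps)
      have "(\<Sum>k<n. ?h (D k)) \<le> (\<Sum>k<2*n. ?h (D k))"
        by (rule sum_mono2) auto
      also have "\<dots> \<le> ?h A + ?h A"
        unfolding split using part[where n = n and p = 0] part[where n = n and p = 1] by (intro add_mono) auto
      finally show ?thesis by (simp add: mult_2)
    qed
    then have "(\<Sum>k. ?h (D k)) \<le> 2 * ?h A"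
      by (intro suminf_le_const) auto
    then have finD: "(\<Sum>k. ?h (D k)) \<noteq> \<infinity>"
      using fin by (auto simp: ennreal_mult_eq_top_iff top_unique)
    have tail: "(\<lambda>n. \<Sum>k. ?h (D (k + n))) \<longlonglongrightarrow> 0"
    proof -
      define d where "d k = enn2real (?h (D k))" for k
      have nt: "?h (D k) \<noteq> \<infinity>" for k
        using finD ennreal_suminf_lessD[of "\<lambda>k. ?h (D k)" top k] by (auto simp: less_top)
      have d: "?h (D k) = ennreal (d k)" "0 \<le> d k" for k
        using nt[of k] by (auto simp: d_def less_top)
      have summ: "summable d"
        using finD d by (intro summable_suminf_not_top) auto
      have "(\<lambda>n. ennreal (\<Sum>k. d (k + n))) \<longlonglongrightarrow> ennreal 0"
        by (intro tendsto_ennrealI suminf_exist_split2 summ)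
      moreover have "(\<Sum>k. ?h (D (k + n))) = ennreal (\<Sum>k. d (k + n))" for n
        unfolding d(1) using summ d(2)
        by (intro suminf_ennreal2) (auto simp: summable_iff_shift)
      ultimately show ?thesis by simp
    qed
    have "?h (A \<inter> F) + ?h (A - F) \<le> ?h A + (\<Sum>k. ?h (D (k + n)))" for n
    proof -
      have "?h (A - F) \<le> ?h (S n) + ?h (\<Union>k. D (k + n))"
        using mono[OF cover[of n]] sub order_trans by blast
      also have "\<dots> \<le> ?h (S n) + (\<Sum>k. ?h (D (k + n)))"
        by (intro add_left_mono csub)
      finally have "?h (A \<inter> F) + ?h (A - F) \<le> (?h (S n) + ?h (A \<inter> F)) + (\<Sum>k. ?h (D (k + n)))"
        by (metis (no_types, lifting) add.assoc add.commute add_left_mono)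
      also have "?h (S n) + ?h (A \<inter> F) \<le> ?h (S n \<union> (A \<inter> F))"
        by (rule sepd[of _ "1 / real (Suc n)" _ 0]) (auto simp: S_def)
      also have "\<dots> \<le> ?h A"
        using SA[of n] by (intro mono) auto
      finally show ?thesis by (simp add: add_right_mono)
    qed
    then have "?h (A \<inter> F) + ?h (A - F) \<le> ?h A + 0"
      by (intro LIMSEQ_le_const[OF tendsto_add[OF tendsto_const tail]]) blast
    then show ?thesis by simp
  qed
  show ?thesis
    unfolding P.lambda_system_eq
  proof (safe intro!: antisym main)
    fix A
    show "?h A \<le> ?h (A \<inter> F) + ?h (A - F)"
      using sub[of "A \<inter> F" "A - F"] by (simp add: Int_Diff_Un)
  qed auto
qed

lemma emeasure_surface_measure:
  assumes "A \<in> sets borel"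
  shows "emeasure surface_measure A = hausdorff_area A"
proof -
  interpret P: sigma_algebra UNIV "Pow UNIV :: 'a set set" by (rule sigma_algebra_Pow)
  let ?L = "lambda_system UNIV (Pow UNIV) (hausdorff_area :: 'a set \<Rightarrow> ennreal)"
  have ms: "measure_space UNIV ?L hausdorff_area"
    by (rule P.caratheodory_lemma[OF outer_measure_space_hausdorff_area])
  then interpret L: sigma_algebra UNIV ?L by (simp add: measure_space_def)
  have sub: "sets borel \<subseteq> ?L"
    unfolding borel_eq_closed
  proof (subst sets_measure_of)
    show "sigma_sets UNIV (Collect closed) \<subseteq> ?L"
      by (rule L.sigma_sets_subset) (use closed_in_lambda_system_hausdorff_area in blast)
  qed simp
  have "countably_additive (sets borel) (hausdorff_area :: 'a set \<Rightarrow> ennreal)"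
    using ms sub unfolding measure_space_def countably_additive_def by blast
  moreover have "positive (sets borel) (hausdorff_area :: 'a set \<Rightarrow> ennreal)"
    using ms by (simp add: measure_space_def positive_def)
  moreover have "sigma_algebra UNIV (sets (borel :: 'a measure))"
    using sets.sigma_algebra_axioms[of borel] by simp
  ultimately show ?thesis
    unfolding surface_measure_def using assms
    by (intro emeasure_measure_of_sigma)
qed


section \<open>Derivatives on the closure of a domain\<close>

text \<open>
  The new index of \<open>nabla f x\<close> is the outermost one:
  \<open>nabla f x $ j\<close> is the partial derivative of \<open>f\<close> in direction \<open>j\<close>. So \<open>nabla u x $ j $ i\<close> is the
  derivative of the \<open>i\<close>-th component of \<open>u\<close> in direction \<open>j\<close>, and iteration gives the higher
  derivative tensors.
\<close>

definition nabla :: "(real^3 \<Rightarrow> 'b::real_normed_vector) \<Rightarrow> real^3 \<Rightarrow> 'b^3" where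
  "nabla f x = (\<chi> j. frechet_derivative f (at x) (axis j 1))"

text \<open>
  Derivatives of a field on the closure of \<open>\<Omega>\<close> are taken in the open set \<open>\<Omega>\<close> and extended to
  the boundary by continuity (the usual meaning of derivatives of functions of class \<open>C\<^sup>k\<close>
  on the closure of a domain).
\<close>

definition extend_to_closure ::
  "(real^3) set \<Rightarrow> (real^3 \<Rightarrow> 'b::t2_space) \<Rightarrow> real^3 \<Rightarrow> 'b" where
  "extend_to_closure \<Omega> g x = (if x \<in> \<Omega> then g x else Lim (at x within \<Omega>) g)"

type_synonym local_law =
  "real^3 \<Rightarrow> real \<Rightarrow> real^3 \<Rightarrow> real^3 \<Rightarrow> real^3^3 \<Rightarrow> real^3^3^3 \<Rightarrow> real^3^3^3^3 \<Rightarrow> ennreal"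

definition local_value ::
  "local_law \<Rightarrow> (real^3) set \<Rightarrow> (real^3 \<Rightarrow> real^3) \<Rightarrow> (real^3 \<Rightarrow> real) \<Rightarrow> real^3 \<Rightarrow> ennreal" where
  "local_value N \<Omega> u T x =
     N x (T x) (extend_to_closure \<Omega> (nabla T) x)
       (u x) (extend_to_closure \<Omega> (nabla u) x)
       (extend_to_closure \<Omega> (nabla (nabla u)) x)
       (extend_to_closure \<Omega> (nabla (nabla (nabla u))) x)"

definition bounded_domain :: "'a::metric_space set \<Rightarrow> bool" where
  "bounded_domain \<Omega> \<longleftrightarrow> open \<Omega> \<and> connected \<Omega> \<and> bounded \<Omega> \<and> \<Omega> \<noteq> {}"


section \<open>Point processes\<close>

definition radon_measure_on :: "'a::topological_space set \<Rightarrow> 'a measure \<Rightarrow> bool" where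
  "radon_measure_on S \<mu> \<longleftrightarrow>
     space \<mu> = S \<and> sets \<mu> = sets (restrict_space borel S) \<and>
     (\<forall>K\<subseteq>S. compact K \<longrightarrow> emeasure \<mu> K < \<infinity>)"

definition point_process ::
  "'w measure \<Rightarrow> 'a::topological_space set \<Rightarrow> ('w \<Rightarrow> 'a measure) \<Rightarrow> bool" where
  "point_process P S \<gamma> \<longleftrightarrow>
     prob_space P \<and>
     (\<forall>\<omega>\<in>space P. radon_measure_on S (\<gamma> \<omega>) \<and>
        (\<forall>B\<in>sets (restrict_space borel S). emeasure (\<gamma> \<omega>) B \<in> range ennreal_of_enat)) \<and>
     (\<forall>B\<in>sets (restrict_space borel S). (\<lambda>\<omega>. emeasure (\<gamma> \<omega>) B) \<in> borel_measurable P)"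

definition poisson_point_process ::
  "'w measure \<Rightarrow> 'a::topological_space set \<Rightarrow> 'a measure \<Rightarrow> ('w \<Rightarrow> 'a measure) \<Rightarrow> bool" where
  "poisson_point_process P S \<rho> \<gamma> \<longleftrightarrow>
     point_process P S \<gamma> \<and> radon_measure_on S \<rho> \<and>
     (\<forall>B\<in>sets (restrict_space borel S). emeasure \<rho> B < \<infinity> \<longrightarrow>
        (\<forall>n::nat. measure P {\<omega>\<in>space P. emeasure (\<gamma> \<omega>) B = of_nat n} =
           (measure \<rho> B) ^ n / fact n * exp (- measure \<rho> B))) \<and>
     (\<forall>(n::nat) B. (\<forall>i<n. B i \<in> sets (restrict_space borel S)) \<longrightarrow>
        disjoint_family_on B {..<n} \<longrightarrow>
        prob_space.indep_vars P (\<lambda>_. borel) (\<lambda>i \<omega>. emeasure (\<gamma> \<omega>) (B i)) {..<n})"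


section \<open>The local Weibull model\<close>

text \<open>
  Real powers of extended nonnegative numbers, meant for exponents \<open>a \<ge> 0\<close>. In contrast to
  \<open>powr\<close> on the reals, the zeroth power of 0 is 1.
\<close>

definition ennpowr :: "ennreal \<Rightarrow> real \<Rightarrow> ennreal" where
  "ennpowr x a = (if a = 0 then 1 else if x = \<infinity> then \<infinity> else ennreal (enn2real x powr a))"

text \<open>Division in \<^typ>\<open>ennreal\<close> satisfies \<open>1 / \<infinity> = 0\<close> and \<open>1 / 0 = \<infinity>\<close>.\<close>

definition weibull_intensity_density :: "real \<Rightarrow> ennreal \<Rightarrow> real \<Rightarrow> ennreal" where
  "weibull_intensity_density m N t = ennreal m / N * ennpowr (ennreal t / N) (m - 1)"

abbreviation crack_space :: "(real^3) set \<Rightarrow> (real \<times> (real^3)) set" where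
  "crack_space \<Omega> \<equiv> {0..} \<times> closure \<Omega>"

text \<open>
  The integrals with respect to \<open>dt dx\<close> and \<open>dt dA\<close> are written as iterated integrals. This
  agrees with the product measure in the \<open>\<sigma>\<close>-finite case and makes sense without it.
\<close>

definition weibull_intensity ::
  "real \<Rightarrow> local_law \<Rightarrow> local_law \<Rightarrow>
     (real^3) set \<Rightarrow> (real^3 \<Rightarrow> real^3) \<Rightarrow> (real^3 \<Rightarrow> real) \<Rightarrow> (real \<times> (real^3)) measure" where
  "weibull_intensity m Nvol Nsur \<Omega> u T =
     measure_of (crack_space \<Omega>) (sets (restrict_space borel (crack_space \<Omega>))) (\<lambda>C.
       (\<integral>\<^sup>+x. (\<integral>\<^sup>+t. weibull_intensity_density m (local_value Nvol \<Omega> u T x) t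
                  * indicator (C \<inter> (UNIV \<times> \<Omega>)) (t, x) \<partial>lborel) \<partial>lborel) +
       (\<integral>\<^sup>+x. (\<integral>\<^sup>+t. weibull_intensity_density m (local_value Nsur \<Omega> u T x) t
                  * indicator (C \<inter> (UNIV \<times> frontier \<Omega>)) (t, x) \<partial>lborel) \<partial>surface_measure))"

lemma borel_measurable_ennpowr [measurable (raw)]:
  assumes [measurable]: "f \<in> borel_measurable M"
  shows "(\<lambda>x. ennpowr (f x) a) \<in> borel_measurable M"
  unfolding ennpowr_def by measurable

lemma borel_measurable_weibull_intensity_density [measurable (raw)]:
  assumes [measurable]: "f \<in> borel_measurable M" "g \<in> borel_measurable M"
  shows "(\<lambda>x. weibull_intensity_density m (f x) (g x)) \<in> borel_measurable M"
  unfolding weibull_intensity_density_def by measurable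

lemma countably_additive_weibull_part:
  fixes N :: "real^3 \<Rightarrow> ennreal"
  assumes M: "sets M = sets borel" and E: "E \<in> sets borel" and S: "S \<in> sets borel"
    and N: "N \<in> borel_measurable (restrict_space borel E)"
  shows "countably_additive (sets (restrict_space borel S)) (\<lambda>C.
    \<integral>\<^sup>+x. (\<integral>\<^sup>+t. weibull_intensity_density m (N x) t
      * indicator (C \<inter> (UNIV \<times> E)) (t, x) \<partial>lborel) \<partial>M)"
proof -
  note [measurable_cong] = M
  note [measurable] = E
  define N' where "N' x = (if x \<in> E then N x else \<top>)" for x
  have [measurable]: "N' \<in> borel_measurable borel"
    unfolding N'_def using N E by (subst measurable_If_restrict_space_iff) auto
  have eq: "weibull_intensity_density m (N x) t * indicator (C \<inter> (UNIV \<times> E)) (t, x) =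
      weibull_intensity_density m (N' x) t * indicator (C \<inter> (UNIV \<times> E)) (t, x)" for x t C
    by (auto simp: N'_def indicator_def)
  show ?thesis
    unfolding countably_additive_def eq
  proof (intro allI impI)
    fix A :: "nat \<Rightarrow> (real \<times> (real^3)) set"
    assume A: "range A \<subseteq> sets (restrict_space borel S)" "disjoint_family A"
    have "A i \<in> sets borel" for i
      using A(1) S sets_restrict_space_iff[of S borel "A i"] by auto
    then have [measurable]: "A i \<in> sets (borel \<Otimes>\<^sub>M borel)" for i
      by (simp only: borel_prod)
    have ind: "indicator ((\<Union>i. A i) \<inter> (UNIV \<times> E)) z =
        (\<Sum>i. indicator (A i \<inter> (UNIV \<times> E)) z :: ennreal)" for z
    proof -
      have "disjoint_family (\<lambda>i. A i \<inter> (UNIV \<times> E))"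
        using A(2) unfolding disjoint_family_on_def by blast
      from suminf_indicator[OF this, of z] show ?thesis by simp
    qed
    show "(\<Sum>i. \<integral>\<^sup>+x. (\<integral>\<^sup>+t. weibull_intensity_density m (N' x) t
          * indicator (A i \<inter> (UNIV \<times> E)) (t, x) \<partial>lborel) \<partial>M) =
        (\<integral>\<^sup>+x. (\<integral>\<^sup>+t. weibull_intensity_density m (N' x) t
          * indicator ((\<Union>i. A i) \<inter> (UNIV \<times> E)) (t, x) \<partial>lborel) \<partial>M)"
      unfolding ind ennreal_suminf_cmult[symmetric]
      by (subst nn_integral_suminf[symmetric], measurable)
         (intro nn_integral_cong, subst nn_integral_suminf[symmetric], measurable)
  qed
qed

lemma emeasure_weibull_intensity:
  assumes \<Omega>: "open \<Omega>"
    and Nvol: "local_value Nvol \<Omega> u T \<in> borel_measurable (restrict_space borel \<Omega>)"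
    and Nsur: "local_value Nsur \<Omega> u T \<in> borel_measurable (restrict_space borel (frontier \<Omega>))"
    and C: "C \<in> sets (restrict_space borel (crack_space \<Omega>))"
  shows "emeasure (weibull_intensity m Nvol Nsur \<Omega> u T) C =
       (\<integral>\<^sup>+x. (\<integral>\<^sup>+t. weibull_intensity_density m (local_value Nvol \<Omega> u T x) t
                  * indicator (C \<inter> (UNIV \<times> \<Omega>)) (t, x) \<partial>lborel) \<partial>lborel) +
       (\<integral>\<^sup>+x. (\<integral>\<^sup>+t. weibull_intensity_density m (local_value Nsur \<Omega> u T x) t
                  * indicator (C \<inter> (UNIV \<times> frontier \<Omega>)) (t, x) \<partial>lborel) \<partial>surface_measure)"
proof -
  have S: "crack_space \<Omega> \<in> sets borel"
    by (intro borel_closed closed_Times) auto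
  have ca: "countably_additive (sets (restrict_space borel (crack_space \<Omega>))) (\<lambda>C. f C + g C)"
    if "countably_additive (sets (restrict_space borel (crack_space \<Omega>))) f"
       "countably_additive (sets (restrict_space borel (crack_space \<Omega>))) g"
    for f g :: "(real \<times> (real^3)) set \<Rightarrow> ennreal"
    using that by (auto simp: countably_additive_def suminf_add[symmetric])
  have sa: "sigma_algebra (crack_space \<Omega>) (sets (restrict_space borel (crack_space \<Omega>)))"
    using sets.sigma_algebra_axioms[of "restrict_space borel (crack_space \<Omega>)"]
    by (simp add: space_restrict_space)
  show ?thesis
    unfolding weibull_intensity_def
  proof (rule emeasure_measure_of_sigma[OF sa _ _ C])
    show "countably_additive (sets (restrict_space borel (crack_space \<Omega>))) (\<lambda>C.
       (\<integral>\<^sup>+x. (\<integral>\<^sup>+t. weibull_intensity_density m (local_value Nvol \<Omega> u T x) t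
                  * indicator (C \<inter> (UNIV \<times> \<Omega>)) (t, x) \<partial>lborel) \<partial>lborel) +
       (\<integral>\<^sup>+x. (\<integral>\<^sup>+t. weibull_intensity_density m (local_value Nsur \<Omega> u T x) t
                  * indicator (C \<inter> (UNIV \<times> frontier \<Omega>)) (t, x) \<partial>lborel) \<partial>surface_measure))"
      using \<Omega> Nvol Nsur S
      by (intro ca countably_additive_weibull_part) (auto simp: sets_surface_measure)
  qed (simp add: positive_def)
qed

definition local_weibull_model ::
  "real \<Rightarrow> local_law \<Rightarrow> local_law \<Rightarrow>
     (real^3) set \<Rightarrow> (real^3 \<Rightarrow> real^3) \<Rightarrow> (real^3 \<Rightarrow> real) \<Rightarrow>
     'w measure \<Rightarrow> ('w \<Rightarrow> (real \<times> (real^3)) measure) \<Rightarrow> bool" where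
  "local_weibull_model m Nvol Nsur \<Omega> u T P \<gamma> \<longleftrightarrow>
     local_value Nvol \<Omega> u T \<in> borel_measurable (restrict_space borel \<Omega>) \<and>
     local_value Nsur \<Omega> u T \<in> borel_measurable (restrict_space borel (frontier \<Omega>)) \<and>
     poisson_point_process P (crack_space \<Omega>) (weibull_intensity m Nvol Nsur \<Omega> u T) \<gamma>"

definition cost_J ::
  "real \<Rightarrow> local_law \<Rightarrow> local_law \<Rightarrow>
     (real^3) set \<Rightarrow> (real^3 \<Rightarrow> real^3) \<Rightarrow> (real^3 \<Rightarrow> real) \<Rightarrow> ennreal" where
  "cost_J m Nvol Nsur \<Omega> u T =
     (\<integral>\<^sup>+x\<in>\<Omega>. ennpowr (1 / local_value Nvol \<Omega> u T x) m \<partial>lborel) +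
     (\<integral>\<^sup>+x\<in>frontier \<Omega>. ennpowr (1 / local_value Nsur \<Omega> u T x) m \<partial>surface_measure)"


section \<open>First failure time and optimal reliability\<close>

text \<open>The first failure time is \<open>\<infinity>\<close> if there is no crack at all.\<close>

definition first_failure_time ::
  "(real^3) set \<Rightarrow> ('w \<Rightarrow> (real \<times> (real^3)) measure) \<Rightarrow> 'w \<Rightarrow> ereal" where
  "first_failure_time \<Omega> \<gamma> \<omega> =
     Inf (ereal ` {t. 0 \<le> t \<and> emeasure (\<gamma> \<omega>) ({0..t} \<times> closure \<Omega>) > 0})"

definition distribution_function :: "'w measure \<Rightarrow> ('w \<Rightarrow> ereal) \<Rightarrow> real \<Rightarrow> real" where
  "distribution_function P \<tau> s = measure P {\<omega>\<in>space P. \<tau> \<omega> \<le> ereal s}"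

definition is_density_of :: "(real \<Rightarrow> real) \<Rightarrow> (real \<Rightarrow> real) \<Rightarrow> bool" where
  "is_density_of F f \<longleftrightarrow>
     f \<in> borel_measurable borel \<and> (\<forall>x. 0 \<le> f x) \<and>
     (\<forall>s. ennreal (F s) = (\<integral>\<^sup>+x\<in>{..s}. ennreal (f x) \<partial>lborel))"

text \<open>
  A density is determined only almost everywhere, whereas the hazard rate is evaluated at every
  time \<open>s \<ge> 0\<close>. So the version of the density that is continuous on \<open>[0, \<infinity>)\<close> is
  taken; its values on \<open>[0, \<infinity>)\<close> are uniquely determined. The density may have total
  mass less than 1, namely if the random time is infinite with positive probability.
\<close>

definition density_function :: "'w measure \<Rightarrow> ('w \<Rightarrow> ereal) \<Rightarrow> real \<Rightarrow> real" where
  "density_function P \<tau> =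
     (SOME f. is_density_of (distribution_function P \<tau>) f \<and> continuous_on {0..} f)"

definition hazard_rate :: "'w measure \<Rightarrow> ('w \<Rightarrow> ereal) \<Rightarrow> real \<Rightarrow> real" where
  "hazard_rate P \<tau> s = density_function P \<tau> s / (1 - distribution_function P \<tau> s)"

definition optimal_at_time ::
  "(real^3) set set \<Rightarrow> ((real^3) set \<Rightarrow> 'w measure) \<Rightarrow>
     ((real^3) set \<Rightarrow> 'w \<Rightarrow> (real \<times> (real^3)) measure) \<Rightarrow> real \<Rightarrow> (real^3) set \<Rightarrow> bool" where
  "optimal_at_time \<O> P \<gamma> t \<Omega>\<^sub>0 \<longleftrightarrow> \<Omega>\<^sub>0 \<in> \<O> \<and>
     (\<forall>\<Omega>\<in>\<O>. distribution_function (P \<Omega>\<^sub>0) (first_failure_time \<Omega>\<^sub>0 (\<gamma> \<Omega>\<^sub>0)) t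
            \<le> distribution_function (P \<Omega>) (first_failure_time \<Omega> (\<gamma> \<Omega>)) t)"

definition optimal_instantaneous_hazard ::
  "(real^3) set set \<Rightarrow> ((real^3) set \<Rightarrow> 'w measure) \<Rightarrow>
     ((real^3) set \<Rightarrow> 'w \<Rightarrow> (real \<times> (real^3)) measure) \<Rightarrow> (real^3) set \<Rightarrow> bool" where
  "optimal_instantaneous_hazard \<O> P \<gamma> \<Omega>\<^sub>0 \<longleftrightarrow> \<Omega>\<^sub>0 \<in> \<O> \<and>
     (\<forall>s\<ge>0. \<forall>\<Omega>\<in>\<O>. hazard_rate (P \<Omega>\<^sub>0) (first_failure_time \<Omega>\<^sub>0 (\<gamma> \<Omega>\<^sub>0)) s
                 \<le> hazard_rate (P \<Omega>) (first_failure_time \<Omega> (\<gamma> \<Omega>)) s)"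

end

theory Submission
  imports Defs
begin

text \<open>
  Since \<open>\<integral>\<^sub>0\<^sup>s (m/N) (t/N)\<^bsup>m-1\<^esup> dt = s\<^sup>m (1/N)\<^sup>m\<close>, also for \<open>N \<in> {0, \<infinity>}\<close>, the intensity of
  \<open>[0,s] \<times> closure \<Omega>\<close> is \<open>s\<^sup>m J(\<Omega>)\<close>, and \<open>J(\<Omega>)\<close> is finite by the Radon property. The void
  probability of the Poisson process gives \<open>F(s) = 1 - exp (- s\<^sup>m J(\<Omega>))\<close> and hence the hazard
  rate \<open>m s\<^bsup>m-1\<^esup> J(\<Omega>)\<close>. For \<open>s > 0\<close> both are strictly increasing in \<open>J(\<Omega>)\<close>.
\<close>

section \<open>Real powers with exponent zero\<close>

text \<open>In contrast to \<open>powr\<close>, the value at \<open>(0, 0)\<close> is 1, as required by the constant hazard rate for \<open>m = 1\<close>.\<close>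

definition rpow :: "real \<Rightarrow> real \<Rightarrow> real" where
  "rpow x a = (if a = 0 then 1 else x powr a)"

lemma rpow_nonneg [simp]: "0 \<le> rpow x a"
  by (simp add: rpow_def)

lemma rpow_1 [simp]: "rpow 1 a = 1"
  by (simp add: rpow_def)

lemma rpow_pos: "0 < x \<Longrightarrow> rpow x a = x powr a"
  by (simp add: rpow_def)

lemma borel_measurable_rpow [measurable]: "(\<lambda>x. rpow x a) \<in> borel_measurable borel"
  unfolding rpow_def by measurable

lemma continuous_on_rpow: "0 \<le> a \<Longrightarrow> continuous_on {0..} (\<lambda>x. rpow x a)"
  unfolding rpow_def by (cases "a = 0") (auto intro!: continuous_intros continuous_on_powr')

lemma ennpowr_ennreal: "0 \<le> x \<Longrightarrow> ennpowr (ennreal x) a = ennreal (rpow x a)"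
  by (simp add: ennpowr_def rpow_def)

section \<open>Integrals over intervals\<close>

text \<open>The derivative is demanded in the open interval only: the antiderivatives below involve
  \<open>t powr m\<close>, and a two-sided derivative at 0 would depend on \<open>powr\<close> at
  negative arguments.\<close>

lemma nn_integral_FTC_interior:
  fixes f F :: "real \<Rightarrow> real"
  assumes "a \<le> b" and "continuous_on {a..b} F"
    and "\<And>x. a < x \<Longrightarrow> x < b \<Longrightarrow> (F has_real_derivative f x) (at x)"
    and "\<And>x. a \<le> x \<Longrightarrow> x \<le> b \<Longrightarrow> 0 \<le> f x"
  shows "(\<integral>\<^sup>+x. ennreal (f x) * indicator {a..b} x \<partial>lborel) = ennreal (F b - F a)"
proof (rule nn_integral_has_integral_lebesgue')
  show "(f has_integral F b - F a) {a..b}"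
    using assms(1-3) by (intro fundamental_theorem_of_calculus_interior)
      (auto simp: has_real_derivative_iff_has_vector_derivative)
qed (use assms(4) in auto)

text \<open>For finite positive \<open>N\<close> the density has the antiderivative
  \<open>(t / N) powr m\<close>; for \<open>N = 0\<close> and \<open>N = \<infinity>\<close> both
  sides are evaluated with the conventions of \<open>ennreal\<close>.\<close>

lemma nn_integral_weibull_intensity_density:
  assumes m: "1 \<le> m" and s: "0 \<le> s"
  shows "(\<integral>\<^sup>+t. weibull_intensity_density m N t * indicator {0..s} t \<partial>lborel) =
    ennreal (s powr m) * ennpowr (1 / N) m"
proof -
  \<comment> \<open>The case \<open>s = 0\<close> is separate because \<open>N = 0\<close> then
    gives \<open>0 * \<infinity> = 0\<close> on the right; on the left the interval is a null
    set.\<close>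
  consider "s = 0" | "N = 0" "0 < s" | "N = \<infinity>" | r where "N = ennreal r" "0 < r"
    by (cases N) (use s in \<open>auto simp: less_le\<close>)
  then show ?thesis
  proof cases
    case 1
    have "(\<integral>\<^sup>+t. weibull_intensity_density m N t * indicator {0..s} t \<partial>lborel) = (\<integral>\<^sup>+(t::real). 0 \<partial>lborel)"
      using AE_lborel_singleton[of "0::real"]
      by (intro nn_integral_cong_AE) (auto simp: 1 elim: eventually_mono)
    then show ?thesis
      using 1 m by simp
  next
    case 2
    \<comment> \<open>The point \<open>t = 0\<close> is left out: there \<open>0 / 0 = 0\<close> in
      \<open>ennreal\<close>, so the density is 0 for \<open>m > 1\<close>. The interval
      \<open>{0<..s}\<close> still has positive length, which forces the integral to be
      infinite.\<close>
    have top: "weibull_intensity_density m N t = \<infinity>" if "0 < t" for t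
      using m that by (auto simp: 2 weibull_intensity_density_def ennpowr_def ennreal_mult_eq_top_iff)
    have "\<infinity> = \<infinity> * emeasure lborel {0<..s}"
      using 2 by (simp add: ennreal_top_mult)
    also have "\<dots> = (\<integral>\<^sup>+t. \<infinity> * indicator {0<..s} t \<partial>lborel)"
      by (subst nn_integral_cmult_indicator) auto
    also have "\<dots> \<le> (\<integral>\<^sup>+t. weibull_intensity_density m N t * indicator {0..s} t \<partial>lborel)"
      by (intro nn_integral_mono) (auto simp: indicator_def top)
    finally show ?thesis
      using 2 m by (simp add: ennpowr_def top_unique ennreal_mult_top)
  next
    case 3
    then show ?thesis
      using m by (simp add: weibull_intensity_density_def ennpowr_def)
  next
    case 4
    \<comment> \<open>With \<open>rpow\<close> the real integrand agrees with the density at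
      \<open>t = 0\<close> as well, where for \<open>m = 1\<close> it equals
      \<open>1 / r\<close>.\<close>
    let ?g = "\<lambda>t. m / r * rpow (t / r) (m - 1)"
    have "(\<integral>\<^sup>+t. weibull_intensity_density m N t * indicator {0..s} t \<partial>lborel) =
        (\<integral>\<^sup>+t. ennreal (?g t) * indicator {0..s} t \<partial>lborel)"
      using 4 m by (intro nn_integral_cong)
        (auto simp: indicator_def weibull_intensity_density_def divide_ennreal ennpowr_ennreal ennreal_mult[symmetric])
    also have "\<dots> = ennreal ((s / r) powr m - (0 / r) powr m)"
    proof (rule nn_integral_FTC_interior)
      show "continuous_on {0..s} (\<lambda>t. (t / r) powr m)"
        using 4 m by (intro continuous_intros continuous_on_powr') auto
      show "((\<lambda>t. (t / r) powr m) has_real_derivative ?g x) (at x)" if "0 < x" for x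
        using that 4 by (auto intro!: derivative_eq_intros simp: rpow_pos powr_diff field_simps)
    qed (use 4 m s in auto)
    also have "\<dots> = ennreal (s powr m) * ennpowr (1 / N) m"
      using 4 m s
      by (simp add: divide_ennreal ennpowr_ennreal rpow_def powr_divide ennreal_mult[symmetric] flip: ennreal_1)
    finally show ?thesis .
  qed
qed

section \<open>Intensity of the space-time cylinders\<close>

text \<open>For fixed \<open>x\<close> in \<open>E\<close> the cylinder leaves just the time
  interval, so the inner integral is already known. The measure \<open>M\<close> is kept general to
  cover both volume and surface.\<close>

lemma nn_integral_weibull_part:
  fixes N :: "real^3 \<Rightarrow> ennreal"
  assumes m: "1 \<le> m" and s: "0 \<le> s" and M: "sets M = sets borel"
    and E: "E \<in> sets borel" "E \<subseteq> K"
    and N: "N \<in> borel_measurable (restrict_space borel E)"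
  shows "(\<integral>\<^sup>+x. (\<integral>\<^sup>+t. weibull_intensity_density m (N x) t
      * indicator (({0..s} \<times> K) \<inter> (UNIV \<times> E)) (t, x) \<partial>lborel) \<partial>M) =
    ennreal (s powr m) * (\<integral>\<^sup>+x\<in>E. ennpowr (1 / N x) m \<partial>M)"
proof -
  have "(\<lambda>x. ennpowr (1 / N x) m) \<in> borel_measurable (restrict_space borel E)"
    using N by measurable
  then have meas: "(\<lambda>x. ennpowr (1 / N x) m * indicator E x) \<in> borel_measurable M"
    using E by (simp add: borel_measurable_restrict_space_iff_ennreal measurable_cong_sets[OF M refl])
  have "(\<integral>\<^sup>+t. weibull_intensity_density m (N x) t
      * indicator (({0..s} \<times> K) \<inter> (UNIV \<times> E)) (t, x) \<partial>lborel) =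
      ennreal (s powr m) * (ennpowr (1 / N x) m * indicator E x)" for x
  proof (cases "x \<in> E")
    case True
    then have "indicator (({0..s} \<times> K) \<inter> (UNIV \<times> E)) (t, x) = (indicator {0..s} t :: ennreal)" for t
      using E by (auto simp: indicator_def)
    then show ?thesis
      using True by (simp add: nn_integral_weibull_intensity_density[OF m s])
  qed simp
  then show ?thesis
    by (simp add: nn_integral_cmult[OF meas])
qed

lemma cylinder_in_sets: "{0..s} \<times> closure \<Omega> \<in> sets (restrict_space borel (crack_space \<Omega>))"
proof -
  have "crack_space \<Omega> \<in> sets borel" "{0..s} \<times> closure \<Omega> \<in> sets borel"
    by (auto intro!: borel_closed closed_Times)
  then show ?thesis
    by (subst sets_restrict_space_iff) auto
qed

lemma emeasure_weibull_intensity_cylinder: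
  assumes m: "1 \<le> m" and s: "0 \<le> s" and \<Omega>: "open \<Omega>"
    and Nvol: "local_value Nvol \<Omega> u T \<in> borel_measurable (restrict_space borel \<Omega>)"
    and Nsur: "local_value Nsur \<Omega> u T \<in> borel_measurable (restrict_space borel (frontier \<Omega>))"
  shows "emeasure (weibull_intensity m Nvol Nsur \<Omega> u T) ({0..s} \<times> closure \<Omega>) =
    ennreal (s powr m) * cost_J m Nvol Nsur \<Omega> u T"
proof -
  note emeasure_weibull_intensity[OF \<Omega> Nvol Nsur cylinder_in_sets[of s]]
  also have "(\<integral>\<^sup>+x. (\<integral>\<^sup>+t. weibull_intensity_density m (local_value Nvol \<Omega> u T x) t
        * indicator (({0..s} \<times> closure \<Omega>) \<inter> (UNIV \<times> \<Omega>)) (t, x) \<partial>lborel) \<partial>lborel) =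
      ennreal (s powr m) * (\<integral>\<^sup>+x\<in>\<Omega>. ennpowr (1 / local_value Nvol \<Omega> u T x) m \<partial>lborel)"
    using m s \<Omega> Nvol by (intro nn_integral_weibull_part) (auto simp: closure_subset)
  also have "(\<integral>\<^sup>+x. (\<integral>\<^sup>+t. weibull_intensity_density m (local_value Nsur \<Omega> u T x) t
        * indicator (({0..s} \<times> closure \<Omega>) \<inter> (UNIV \<times> frontier \<Omega>)) (t, x) \<partial>lborel) \<partial>surface_measure) =
      ennreal (s powr m) * (\<integral>\<^sup>+x\<in>frontier \<Omega>. ennpowr (1 / local_value Nsur \<Omega> u T x) m \<partial>surface_measure)"
    using m s Nsur
    by (intro nn_integral_weibull_part) (auto simp: sets_surface_measure frontier_def)
  finally show ?thesis
    by (simp add: cost_J_def distrib_left)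
qed

text \<open>At \<open>s = 1\<close> the factor \<open>s powr m\<close> is 1, so the cost is the
  intensity of a compact cylinder.\<close>

lemma cost_J_finite:
  assumes m: "1 \<le> m" and \<Omega>: "bounded_domain \<Omega>"
    and model: "local_weibull_model m Nvol Nsur \<Omega> u T P \<gamma>"
  shows "cost_J m Nvol Nsur \<Omega> u T < \<infinity>"
proof -
  have "compact ({0..1::real} \<times> closure \<Omega>)"
    using \<Omega> by (intro compact_Times) (auto simp: bounded_domain_def compact_closure)
  moreover have "{0..1} \<times> closure \<Omega> \<subseteq> crack_space \<Omega>"
    by auto
  moreover have "radon_measure_on (crack_space \<Omega>) (weibull_intensity m Nvol Nsur \<Omega> u T)"
    using model by (simp add: local_weibull_model_def poisson_point_process_def)
  ultimately have "emeasure (weibull_intensity m Nvol Nsur \<Omega> u T) ({0..1} \<times> closure \<Omega>) < \<infinity>"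
    unfolding radon_measure_on_def by blast
  then show ?thesis
    using \<Omega> model
    by (subst (asm) emeasure_weibull_intensity_cylinder[OF m])
      (auto simp: bounded_domain_def local_weibull_model_def)
qed

section \<open>The first failure time\<close>

text \<open>
  The infimum is attained: the counts are integers and \<open>\<gamma> \<omega>\<close> is finite on compact sets, so the
  count of \<open>[0,s]\<close> is the limit of the counts of \<open>[0, s + 1/n]\<close>, which are at least 1.
\<close>

lemma first_failure_time_le_iff:
  assumes pp: "point_process P (crack_space \<Omega>) \<gamma>" and \<omega>: "\<omega> \<in> space P"
    and \<Omega>: "bounded \<Omega>" and s: "0 \<le> s"
  shows "first_failure_time \<Omega> \<gamma> \<omega> \<le> ereal s \<longleftrightarrow> 0 < emeasure (\<gamma> \<omega>) ({0..s} \<times> closure \<Omega>)"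
proof
  assume "0 < emeasure (\<gamma> \<omega>) ({0..s} \<times> closure \<Omega>)"
  then show "first_failure_time \<Omega> \<gamma> \<omega> \<le> ereal s"
    unfolding first_failure_time_def using s by (intro Inf_lower) auto
next
  assume le: "first_failure_time \<Omega> \<gamma> \<omega> \<le> ereal s"
  define A where "A n = {0..s + 1 / real (Suc n)} \<times> closure \<Omega>" for n
  have radon: "radon_measure_on (crack_space \<Omega>) (\<gamma> \<omega>)"
    and enat: "\<And>B. B \<in> sets (restrict_space borel (crack_space \<Omega>)) \<Longrightarrow>
      emeasure (\<gamma> \<omega>) B \<in> range ennreal_of_enat"
    using pp \<omega> by (auto simp: point_process_def)
  have compact: "compact (A n)" for n
    unfolding A_def using \<Omega> by (intro compact_Times) (auto simp: compact_closure)
  have sub: "A n \<subseteq> crack_space \<Omega>" for n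
    by (auto simp: A_def)
  have sets: "A n \<in> sets (restrict_space borel (crack_space \<Omega>))" for n
    unfolding A_def by (rule cylinder_in_sets)
  have "1 \<le> emeasure (\<gamma> \<omega>) (A n)" for n
  proof -
    \<comment> \<open>The infimum need not be known to be attained: being strictly below the bound,
      it has an element of the set below the bound too.\<close>
    have "Inf (ereal ` {t. 0 \<le> t \<and> emeasure (\<gamma> \<omega>) ({0..t} \<times> closure \<Omega>) > 0}) <
        ereal (s + 1 / real (Suc n))"
      using le unfolding first_failure_time_def by (rule le_less_trans) simp
    then obtain t where t: "t < s + 1 / real (Suc n)" "0 < emeasure (\<gamma> \<omega>) ({0..t} \<times> closure \<Omega>)"
      unfolding Inf_less_iff by auto
    then have "emeasure (\<gamma> \<omega>) ({0..t} \<times> closure \<Omega>) \<le> emeasure (\<gamma> \<omega>) (A n)"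
      using radon sets[of n] by (intro emeasure_mono) (auto simp: A_def radon_measure_on_def)
    with t have pos: "0 < emeasure (\<gamma> \<omega>) (A n)"
      by simp
    \<comment> \<open>Integrality turns positivity into the uniform lower bound 1, which survives
      the limit.\<close>
    obtain k where k: "emeasure (\<gamma> \<omega>) (A n) = ennreal_of_enat k"
      using enat[OF sets[of n]] by blast
    show ?thesis
    proof (cases k)
      case (enat j)
      then have "0 < j"
        using pos k by (cases j) auto
      then have "real 1 \<le> real j"
        by simp
      then show ?thesis
        using k enat by (metis ennreal_1 ennreal_leI ennreal_of_enat_enat ennreal_of_nat_eq_real_of_nat of_nat_1)
    qed (use k in simp)
  qed
  moreover have "(\<lambda>n. emeasure (\<gamma> \<omega>) (A n)) \<longlonglongrightarrow> emeasure (\<gamma> \<omega>) (\<Inter>n. A n)"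
  proof (rule Lim_emeasure_decseq)
    show "range A \<subseteq> sets (\<gamma> \<omega>)"
      using radon sets by (auto simp: radon_measure_on_def)
    show "decseq A"
    proof (rule decseq_SucI)
      fix n
      have "1 / real (Suc (Suc n)) \<le> 1 / real (Suc n)"
        by (simp add: field_simps)
      then show "A (Suc n) \<subseteq> A n"
        unfolding A_def by (intro Sigma_mono) auto
    qed
    show "emeasure (\<gamma> \<omega>) (A n) \<noteq> \<infinity>" for n
      using radon sub[of n] compact[of n] unfolding radon_measure_on_def by (metis less_irrefl)
  qed
  moreover have "(\<Inter>n. A n) = {0..s} \<times> closure \<Omega>"
  proof -
    have "x \<le> s" if "\<And>n. x \<le> s + 1 / real (Suc n)" for x
    proof (rule field_le_epsilon)
      fix e :: real assume "0 < e"
      then obtain n where "1 / real (Suc n) < e"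
        by (rule nat_approx_posE)
      with that[of n] show "x \<le> s + e"
        by simp
    qed
    moreover have "x \<le> s + 1 / real (Suc n)" if "x \<le> s" for x n
      using that by (intro add_increasing2) auto
    ultimately have "(\<forall>n. x \<le> s + 1 / real (Suc n)) \<longleftrightarrow> x \<le> s" for x
      by blast
    then show ?thesis
      by (auto simp only: A_def mem_Times_iff atLeastAtMost_iff INT_iff set_eq_iff)
  qed
  ultimately have "1 \<le> emeasure (\<gamma> \<omega>) ({0..s} \<times> closure \<Omega>)"
    by (intro LIMSEQ_le_const[of "\<lambda>n. emeasure (\<gamma> \<omega>) (A n)"]) auto
  then show "0 < emeasure (\<gamma> \<omega>) ({0..s} \<times> closure \<Omega>)"
    by (rule less_le_trans[rotated]) simp
qed

text \<open>Failure by time \<open>s\<close> is the complement of the event that the cylinder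
  contains no point, whose probability is the Poisson weight at 0.\<close>

lemma distribution_function_first_failure_time:
  assumes ppp: "poisson_point_process P (crack_space \<Omega>) \<rho> \<gamma>" and \<Omega>: "bounded \<Omega>" and s: "0 \<le> s"
  shows "distribution_function P (first_failure_time \<Omega> \<gamma>) s =
    1 - exp (- measure \<rho> ({0..s} \<times> closure \<Omega>))"
proof -
  let ?B = "{0..s} \<times> closure \<Omega>"
  have pp: "point_process P (crack_space \<Omega>) \<gamma>" and radon: "radon_measure_on (crack_space \<Omega>) \<rho>"
    and void: "\<And>B. B \<in> sets (restrict_space borel (crack_space \<Omega>)) \<Longrightarrow> emeasure \<rho> B < \<infinity> \<Longrightarrow>
      measure P {\<omega>\<in>space P. emeasure (\<gamma> \<omega>) B = of_nat 0} =
      (measure \<rho> B) ^ 0 / fact 0 * exp (- measure \<rho> B)"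
    using ppp unfolding poisson_point_process_def by blast+
  interpret prob_space P
    using pp by (simp add: point_process_def)
  have compact: "compact ?B"
    using \<Omega> by (intro compact_Times) (auto simp: compact_closure)
  have B: "?B \<in> sets (restrict_space borel (crack_space \<Omega>))"
    by (rule cylinder_in_sets)
  have [measurable]: "(\<lambda>\<omega>. emeasure (\<gamma> \<omega>) ?B) \<in> borel_measurable P"
    using pp B by (simp add: point_process_def)
  have "?B \<subseteq> crack_space \<Omega>"
    by auto
  with radon compact have fin: "emeasure \<rho> ?B < \<infinity>"
    unfolding radon_measure_on_def by blast
  have "{\<omega>\<in>space P. first_failure_time \<Omega> \<gamma> \<omega> \<le> ereal s} =
      space P - {\<omega>\<in>space P. emeasure (\<gamma> \<omega>) ?B = 0}"
    using first_failure_time_le_iff[OF pp _ \<Omega> s] by (auto simp: zero_less_iff_neq_zero)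
  then show ?thesis
    using void[OF B fin] by (simp add: distribution_function_def prob_compl)
qed

lemma distribution_function_neg:
  assumes "s < 0"
  shows "distribution_function P (first_failure_time \<Omega> \<gamma>) s = 0"
proof -
  have "0 \<le> first_failure_time \<Omega> \<gamma> \<omega>" for \<omega>
    unfolding first_failure_time_def by (intro Inf_greatest) auto
  then have "\<not> first_failure_time \<Omega> \<gamma> \<omega> \<le> ereal s" for \<omega>
    using assms by (metis ereal_less_eq(5) not_le order_trans)
  then show ?thesis
    by (simp add: distribution_function_def)
qed

lemma distribution_function_weibull:
  assumes m: "1 \<le> m" and \<Omega>: "bounded_domain \<Omega>"
    and model: "local_weibull_model m Nvol Nsur \<Omega> u T P \<gamma>"
  shows "distribution_function P (first_failure_time \<Omega> \<gamma>) s =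
    (if s < 0 then 0 else 1 - exp (- (s powr m * enn2real (cost_J m Nvol Nsur \<Omega> u T))))"
proof (cases "s < 0")
  case False
  let ?\<rho> = "weibull_intensity m Nvol Nsur \<Omega> u T"
  have "distribution_function P (first_failure_time \<Omega> \<gamma>) s =
      1 - exp (- measure ?\<rho> ({0..s} \<times> closure \<Omega>))"
    using model \<Omega> False
    by (intro distribution_function_first_failure_time) (auto simp: local_weibull_model_def bounded_domain_def)
  also have "measure ?\<rho> ({0..s} \<times> closure \<Omega>) = s powr m * enn2real (cost_J m Nvol Nsur \<Omega> u T)"
    unfolding measure_def using False model \<Omega>
    by (subst emeasure_weibull_intensity_cylinder[OF m])
      (auto simp: local_weibull_model_def bounded_domain_def enn2real_mult)
  finally show ?thesis
    using False by simp
qed (simp add: distribution_function_neg)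

section \<open>Density and hazard rate\<close>

text \<open>Continuity says nothing about a density left of 0. The mass there is the same for all
  \<open>s\<close>, and \<open>s = 0\<close> identifies it with \<open>F 0\<close>.\<close>

lemma continuous_density_integral:
  assumes f: "is_density_of F f" "continuous_on {0..} f" and s: "0 \<le> s"
  shows "ennreal (F s) = ennreal (F 0) + ennreal (integral {0..s} f)"
proof -
  have [measurable]: "f \<in> borel_measurable borel" and nn: "\<And>x. 0 \<le> f x"
    and F: "\<And>s. ennreal (F s) = (\<integral>\<^sup>+x. ennreal (f x) * indicator {..s} x \<partial>lborel)"
    using f by (auto simp: is_density_of_def)
  have split: "ennreal (F s) = (\<integral>\<^sup>+x. ennreal (f x) * indicator {..<0} x \<partial>lborel) + ennreal (integral {0..s} f)"
    if "0 \<le> s" for s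
  proof -
    have "ennreal (F s) = (\<integral>\<^sup>+x. ennreal (f x) * indicator {..<0} x + ennreal (f x) * indicator {0..s} x \<partial>lborel)"
      unfolding F using that by (intro nn_integral_cong) (auto simp: indicator_def)
    also have "\<dots> = (\<integral>\<^sup>+x. ennreal (f x) * indicator {..<0} x \<partial>lborel) +
        (\<integral>\<^sup>+x. ennreal (f x) * indicator {0..s} x \<partial>lborel)"
      by (rule nn_integral_add) auto
    also have "(\<integral>\<^sup>+x. ennreal (f x) * indicator {0..s} x \<partial>lborel) = ennreal (integral {0..s} f)"
      using nn f(2) by (intro nn_integral_has_integral_lebesgue' integrable_integral
        integrable_continuous_interval continuous_on_subset[OF f(2)]) auto
    finally show ?thesis .
  qed
  show ?thesis
    using split[of 0] split[OF s] by simp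
qed

text \<open>Both densities have equal integrals from 0, and differentiating these recovers the
  values by continuity. This makes the choice in \<open>density_function\<close> unambiguous on
  \<open>{0..}\<close>.\<close>

lemma continuous_density_unique:
  assumes f: "is_density_of F f" "continuous_on {0..} f"
    and g: "is_density_of F g" "continuous_on {0..} g" and s: "0 \<le> s"
  shows "f s = g s"
proof -
  have eq: "integral {0..x} f = integral {0..x} g" if "0 \<le> x" for x
  proof -
    \<comment> \<open>\<open>ennreal\<close> is injective only on nonnegative reals, so signs are
      needed to return to real integrals.\<close>
    have "0 \<le> integral {0..x} f" "0 \<le> integral {0..x} g"
      using f g by (auto simp: is_density_of_def intro!: Henstock_Kurzweil_Integration.integral_nonneg
        integrable_continuous_interval intro: continuous_on_subset)
    then show ?thesis
      using continuous_density_integral[OF f that] continuous_density_integral[OF g that]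
      by (simp add: ennreal_add_left_cancel)
  qed
  \<comment> \<open>The interval up to \<open>s + 1\<close> is nondegenerate even for
    \<open>s = 0\<close>, where the derivative is one-sided.\<close>
  have D: "((\<lambda>x. integral {0..x} h) has_vector_derivative h s) (at s within cbox 0 (s + 1))"
    if "continuous_on {0..} h" for h :: "real \<Rightarrow> real"
    using integral_has_vector_derivative[of 0 "s + 1" h s] continuous_on_subset[OF that] s by auto
  have "((\<lambda>x. integral {0..x} f) has_vector_derivative g s) (at s within cbox 0 (s + 1))"
    by (rule has_vector_derivative_transform[OF _ _ D[OF g(2)]]) (use s eq in auto)
  with D[OF f(2)] show ?thesis
    using s by (intro vector_derivative_unique_within_closed_interval[of 0 "s + 1" s]) auto
qed

lemma density_function_eq:
  assumes "is_density_of (distribution_function P \<tau>) f" "continuous_on {0..} f" and "0 \<le> s"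
  shows "density_function P \<tau> s = f s"
proof -
  have "is_density_of (distribution_function P \<tau>) (density_function P \<tau>) \<and>
      continuous_on {0..} (density_function P \<tau>)"
    unfolding density_function_def
    by (rule someI[where P = "\<lambda>f. is_density_of (distribution_function P \<tau>) f \<and> continuous_on {0..} f"])
      (use assms in blast)
  then show ?thesis
    using assms continuous_density_unique by blast
qed

text \<open>The derivative of the distribution function is a continuous density on
  \<open>{0..}\<close>; its exponential factor equals \<open>1 - F s\<close> and cancels.\<close>

lemma hazard_rate_weibull:
  assumes m: "1 \<le> m" and \<Omega>: "bounded_domain \<Omega>"
    and model: "local_weibull_model m Nvol Nsur \<Omega> u T P \<gamma>" and s: "0 \<le> s"
  shows "hazard_rate P (first_failure_time \<Omega> \<gamma>) s =
    m * rpow s (m - 1) * enn2real (cost_J m Nvol Nsur \<Omega> u T)"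
proof -
  define J where "J = enn2real (cost_J m Nvol Nsur \<Omega> u T)"
  define F where "F = distribution_function P (first_failure_time \<Omega> \<gamma>)"
  define f where "f x = (if x < 0 then 0 else m * rpow x (m - 1) * J * exp (- (x powr m * J)))" for x
  have F: "F x = (if x < 0 then 0 else 1 - exp (- (x powr m * J)))" for x
    unfolding F_def J_def by (rule distribution_function_weibull[OF m \<Omega> model])
  have J: "0 \<le> J"
    by (simp add: J_def)
  have "is_density_of F f"
    unfolding is_density_of_def
  proof (intro conjI allI)
    show "f \<in> borel_measurable borel"
      unfolding f_def by measurable
    show "0 \<le> f x" for x
      using m J by (simp add: f_def)
    show "ennreal (F x) = (\<integral>\<^sup>+y\<in>{..x}. ennreal (f y) \<partial>lborel)" for x
    proof (cases "x < 0")
      case True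
      then have "(\<integral>\<^sup>+y\<in>{..x}. ennreal (f y) \<partial>lborel) = (\<integral>\<^sup>+(y::real). 0 \<partial>lborel)"
        by (intro nn_integral_cong) (auto simp: f_def indicator_def)
      then show ?thesis
        using True by (simp add: F)
    next
      case False
      have "(\<integral>\<^sup>+y\<in>{..x}. ennreal (f y) \<partial>lborel) = (\<integral>\<^sup>+y\<in>{0..x}. ennreal (f y) \<partial>lborel)"
        by (intro nn_integral_cong) (auto simp: f_def indicator_def)
      \<comment> \<open>The antiderivative is \<open>F\<close> without the constant 1.\<close>
      also have "\<dots> = ennreal (- exp (- (x powr m * J)) - - exp (- (0 powr m * J)))"
      proof (rule nn_integral_FTC_interior)
        show "continuous_on {0..x} (\<lambda>y. - exp (- (y powr m * J)))"
          using m by (intro continuous_intros continuous_on_powr') auto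
        show "((\<lambda>y. - exp (- (y powr m * J))) has_real_derivative f y) (at y)" if "0 < y" for y
          using that by (auto intro!: derivative_eq_intros simp: f_def rpow_pos)
        show "0 \<le> f y" for y
          using m J by (simp add: f_def)
      qed (use False in auto)
      finally show ?thesis
        using False m by (simp add: F)
    qed
  qed
  moreover have "continuous_on {0..} f"
  proof -
    have "continuous_on {0..} (\<lambda>x. m * rpow x (m - 1) * J * exp (- (x powr m * J)))"
      using m by (intro continuous_intros continuous_on_powr' continuous_on_rpow) auto
    then show ?thesis
      by (rule continuous_on_eq) (simp add: f_def)
  qed
  ultimately have "density_function P (first_failure_time \<Omega> \<gamma>) s = f s"
    unfolding F_def using s by (rule density_function_eq)
  then show ?thesis
    using s F[of s] by (simp add: hazard_rate_def F_def f_def J_def)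
qed

section \<open>Comparison of shapes through the cost functional\<close>

theorem proposition2p10:
  fixes \<O> :: "(real^3) set set"
    and T :: "(real^3) set \<Rightarrow> real^3 \<Rightarrow> real"
    and u :: "(real^3) set \<Rightarrow> real^3 \<Rightarrow> real^3"
    and Nvol Nsur :: local_law
    and P :: "(real^3) set \<Rightarrow> 'w measure"
    and \<gamma> :: "(real^3) set \<Rightarrow> 'w \<Rightarrow> (real \<times> (real^3)) measure"
    and m t :: real
    and \<Omega>\<^sub>0 :: "(real^3) set"
  assumes "\<And>\<Omega>. \<Omega> \<in> \<O> \<Longrightarrow> bounded_domain \<Omega>"
    and "m \<ge> 1"
    and "\<And>\<Omega>. \<Omega> \<in> \<O> \<Longrightarrow> local_weibull_model m Nvol Nsur \<Omega> (u \<Omega>) (T \<Omega>) (P \<Omega>) (\<gamma> \<Omega>)"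
    and "t > 0"
    and "\<Omega>\<^sub>0 \<in> \<O>"
  shows "(optimal_instantaneous_hazard \<O> P \<gamma> \<Omega>\<^sub>0 \<longleftrightarrow> optimal_at_time \<O> P \<gamma> t \<Omega>\<^sub>0) \<and>
    (optimal_at_time \<O> P \<gamma> t \<Omega>\<^sub>0 \<longleftrightarrow>
       (\<forall>\<Omega>\<in>\<O>. cost_J m Nvol Nsur \<Omega>\<^sub>0 (u \<Omega>\<^sub>0) (T \<Omega>\<^sub>0) \<le> cost_J m Nvol Nsur \<Omega> (u \<Omega>) (T \<Omega>)))"
proof -
  define J where "J \<Omega> = cost_J m Nvol Nsur \<Omega> (u \<Omega>) (T \<Omega>)" for \<Omega>
  have fin: "J \<Omega> < \<infinity>" if "\<Omega> \<in> \<O>" for \<Omega>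
    unfolding J_def using assms that by (intro cost_J_finite) auto
  \<comment> \<open>Finiteness matters, since \<open>enn2real\<close> sends
    \<open>\<infinity>\<close> to 0.\<close>
  have le: "enn2real (J \<Omega>\<^sub>0) \<le> enn2real (J \<Omega>) \<longleftrightarrow> J \<Omega>\<^sub>0 \<le> J \<Omega>" if "\<Omega> \<in> \<O>" for \<Omega>
    using fin[OF that] fin[OF assms(5)]
    by (cases "J \<Omega>"; cases "J \<Omega>\<^sub>0") (auto simp: ennreal_le_iff)
  have F: "distribution_function (P \<Omega>) (first_failure_time \<Omega> (\<gamma> \<Omega>)) t =
      1 - exp (- (t powr m * enn2real (J \<Omega>)))" if "\<Omega> \<in> \<O>" for \<Omega>
    using distribution_function_weibull[OF assms(2) assms(1)[OF that] assms(3)[OF that], of t] assms(4)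
    by (simp add: J_def)
  have h: "hazard_rate (P \<Omega>) (first_failure_time \<Omega> (\<gamma> \<Omega>)) s =
      m * rpow s (m - 1) * enn2real (J \<Omega>)" if "\<Omega> \<in> \<O>" "0 \<le> s" for \<Omega> s
    using hazard_rate_weibull[OF assms(2) assms(1)[OF that(1)] assms(3)[OF that(1)] that(2)]
    by (simp add: J_def)
  have time: "optimal_at_time \<O> P \<gamma> t \<Omega>\<^sub>0 \<longleftrightarrow> (\<forall>\<Omega>\<in>\<O>. J \<Omega>\<^sub>0 \<le> J \<Omega>)"
    using assms(4,5) by (auto simp: optimal_at_time_def F le[symmetric])
  have "optimal_instantaneous_hazard \<O> P \<gamma> \<Omega>\<^sub>0 \<longleftrightarrow> (\<forall>\<Omega>\<in>\<O>. J \<Omega>\<^sub>0 \<le> J \<Omega>)"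
  proof
    assume "optimal_instantaneous_hazard \<O> P \<gamma> \<Omega>\<^sub>0"
    \<comment> \<open>One positive time suffices, and at 1 the power is 1. Time 0 would give no
      information for \<open>m > 1\<close>, as all hazard rates vanish there.\<close>
    then have "\<forall>\<Omega>\<in>\<O>. hazard_rate (P \<Omega>\<^sub>0) (first_failure_time \<Omega>\<^sub>0 (\<gamma> \<Omega>\<^sub>0)) 1
        \<le> hazard_rate (P \<Omega>) (first_failure_time \<Omega> (\<gamma> \<Omega>)) 1"
      by (simp add: optimal_instantaneous_hazard_def)
    then show "\<forall>\<Omega>\<in>\<O>. J \<Omega>\<^sub>0 \<le> J \<Omega>"
      using assms(2,5) by (auto simp: h le[symmetric])
  next
    assume "\<forall>\<Omega>\<in>\<O>. J \<Omega>\<^sub>0 \<le> J \<Omega>"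
    then show "optimal_instantaneous_hazard \<O> P \<gamma> \<Omega>\<^sub>0"
      using assms(2,5) by (auto simp: optimal_instantaneous_hazard_def h le[symmetric] intro!: mult_left_mono)
  qed
  with time show ?thesis
    by (simp add: J_def)
qed

end
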